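(* Let $n,d\ge1$ and let $v_1,\dots,v_n\in\mathbb{S}^{d-1}$ be unit vectors in $\mathbb{R}^d$. Then there exists a unit vector $u\in\mathbb{S}^{d-1}$ such that $$\prod_{j=1}^n|\langle v_j,u\rangle|\ge n^{-n/2}.$$ Moreover, $\sup_{\|x\|=1}|\langle v_1,x\rangle\cdots\langle v_n,x\rangle|=n^{-n/2}$ if and only if $d\ge n$ and $v_1,\dots,v_n$ form an orthonormal set of $\mathbb{R}^d$.
   Context: $\langle\cdot,\cdot\rangle$ is the standard inner product on $\mathbb{R}^d$ with Euclidean norm $\|\cdot\|$, and $\mathbb{S}^{d-1}$ is the unit sphere of $\mathbb{R}^d$. "Form an orthonormal set" means $\langle v_j,v_k\rangle=\delta_{jk}$ for all $j,k$. *)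

theory Defs
  imports "HOL-Analysis.Analysis"
begin

definition orthonormal_family :: "nat \<Rightarrow> (nat \<Rightarrow> 'a::real_inner) \<Rightarrow> bool" where
  "orthonormal_family n v \<longleftrightarrow>
     (\<forall>j\<in>{1..n}. \<forall>k\<in>{1..n}. v j \<bullet> v k = (if j = k then 1 else 0))"

end

theory Submission
  imports Defs "Jordan_Normal_Form.Determinant"
begin

text \<open>
  Let \<open>A\<close> be the Gram matrix of the unit vectors, assumed invertible for the moment.  The critical
  points of \<open>t \<mapsto> t\<^sup>T A t / 2 - \<Sum> ln \<bar>t\<^sub>i\<bar>\<close> are the \<open>t\<close> with \<open>t\<^sub>i (A t)\<^sub>i = 1\<close> for all \<open>i\<close>.
  For such a \<open>t\<close> the vector \<open>u = \<Sum> t\<^sub>i v\<^sub>i\<close> satisfies \<open>\<langle>v\<^sub>i, u\<rangle> = 1 / t\<^sub>i\<close> and \<open>\<parallel>u\<parallel>\<^sup>2 = n\<close>, so for the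
  lower bound it suffices to find one with \<open>\<Prod> \<bar>t\<^sub>i\<bar> \<le> 1\<close>.  Each of the \<open>2\<^sup>n\<close> open orthants contains
  a critical point (\<open>reciprocal_exists_with_signs\<close>), and a good one is found by averaging over them.

  The weights of the average come from the determinant \<open>K(t, s) = det (1 + diag(t) A diag(s))\<close>.
  Expanding it gives \<open>K(t, s) = \<Sum>\<^sub>S m\<^sub>S t\<^sub>S s\<^sub>S\<close>, the sum over all subsets \<open>S\<close> of the indices, with \<open>m\<^sub>S\<close>
  the principal minor and \<open>t\<^sub>S\<close> the monomial of \<open>S\<close> (\<open>det_kernel_expansion\<close>).  If \<open>t \<noteq> s\<close> are both
  critical then \<open>K(t, s) = 0\<close>, because \<open>(t - s) / s\<close> lies in the null space
  (\<open>det_kernel_distinct_eq_0\<close>), whereas \<open>w\<^sub>t = 1 / K(t, t)\<close> is positive.  So the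
  \<open>2\<^sup>n \<times> 2\<^sup>n\<close> matrix \<open>(t\<^sub>S)\<close> has, up to diagonal factors, orthonormal rows; then its columns are
  orthonormal too, which says that the monomials are orthogonal for the weights \<open>w\<close>.  The
  monomials of degree at most one give
  \<open>\<Sum> w\<^sub>t = 1\<close> and \<open>\<Sum> w\<^sub>t t\<^sub>i t\<^sub>j = \<delta>\<^sub>i\<^sub>j\<close> (\<open>reciprocal_moments\<close>).

  In particular \<open>t\<^sub>i\<^sup>2\<close> has mean \<open>1\<close>, and \<open>ln z \<le> z - 1\<close> already yields some \<open>t\<close> with
  \<open>\<Prod> t\<^sub>i\<^sup>2 \<le> 1\<close>.  For the equality case more is needed.  Since \<open>1 / t\<^sub>i = (A t)\<^sub>i\<close>, the mean of
  \<open>1 / t\<^sub>i\<^sup>2\<close> is \<open>\<Sum>\<^sub>j A\<^sub>i\<^sub>j\<^sup>2\<close>, which exceeds \<open>1\<close> unless row \<open>i\<close> is trivial.  Because \<open>1 / t\<^sub>i\<^sup>2 \<le> n\<close>,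
  a sharper logarithmic inequality (\<open>log_lower_bound\<close>) converts this excess into the gain
  \<open>\<Prod> 1 / t\<^sub>i\<^sup>2 \<ge> exp (\<Sum>\<^sub>i\<^sub>\<noteq>\<^sub>j A\<^sub>i\<^sub>j\<^sup>2 / (n + 1))\<close> (\<open>reciprocal_large_product\<close>).  The gain does not
  depend on how close \<open>A\<close> is to being singular, so it survives the limit \<open>\<delta> \<rightarrow> 0\<close> in
  \<open>(A + \<delta>) / (1 + \<delta>)\<close> and covers linearly dependent vectors (\<open>product_bound_stability\<close>).  It gives
  the lower bound and forces orthonormality in the case of equality; conversely, Bessel's
  inequality and the inequality of arithmetic and geometric means bound the product for an
  orthonormal family.
\<close>

(* Below, the infix dot is the inner product of vectors. *)
no_notation scalar_prod (infix "\<bullet>" 70)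

section \<open>Principal minors and inverse matrices\<close>

definition principal_minor :: "(nat \<Rightarrow> nat \<Rightarrow> real) \<Rightarrow> nat set \<Rightarrow> real" where
  "principal_minor B S = (\<Sum>p | p permutes S. of_int (sign p) * (\<Prod>i\<in>S. B i (p i)))"

lemma principal_minor_eq_det: "principal_minor B {..<n} = Determinant.det (mat n n (\<lambda>(i, j). B i j))"
proof -
  have "Determinant.det (mat n n (\<lambda>(i, j). B i j)) =
     (\<Sum>p | p permutes {..<n}. of_int (sign p) * (\<Prod>i<n. mat n n (\<lambda>(i, j). B i j) $$ (i, p i)))"
    by (subst det_def'[where n = n]) (auto simp: lessThan_atLeast0)
  also have "\<dots> = principal_minor B {..<n}"
    unfolding principal_minor_def
  proof (intro sum.cong refl arg_cong2[where f = "(*)"] prod.cong)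
    fix p i assume "p \<in> {p. p permutes {..<n}}" "i \<in> {..<n}"
    then have "i < n" "p i < n"
      using permutes_in_image[of p "{..<n}" i] by auto
    then show "mat n n (\<lambda>(i, j). B i j) $$ (i, p i) = B i (p i)"
      by simp
  qed
  finally show ?thesis by simp
qed

lemma principal_minor_eq_0_iff:
  "principal_minor B {..<n} = 0 \<longleftrightarrow> (\<exists>y. (\<exists>i<n. y i \<noteq> 0) \<and> (\<forall>i<n. (\<Sum>j<n. B i j * y j) = 0))"
proof -
  let ?B = "mat n n (\<lambda>(i, j). B i j)"
  have prod: "(?B *\<^sub>v vec n y) = 0\<^sub>v n \<longleftrightarrow> (\<forall>i<n. (\<Sum>j<n. B i j * y j) = 0)" for y
    by (auto simp: vec_eq_iff scalar_prod_def lessThan_atLeast0)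
  have nonzero: "vec n y \<noteq> 0\<^sub>v n \<longleftrightarrow> (\<exists>i<n. y i \<noteq> (0::real))" for y
    by (auto simp: vec_eq_iff)
  have "principal_minor B {..<n} = 0 \<longleftrightarrow> (\<exists>v. v \<in> carrier_vec n \<and> v \<noteq> 0\<^sub>v n \<and> ?B *\<^sub>v v = 0\<^sub>v n)"
    unfolding principal_minor_eq_det by (rule det_0_iff_vec_prod_zero_field) simp
  also have "\<dots> \<longleftrightarrow> (\<exists>y. vec n y \<noteq> 0\<^sub>v n \<and> ?B *\<^sub>v vec n y = 0\<^sub>v n)"
    by (metis carrier_vecD eq_vecI dim_vec index_vec vec_carrier)
  finally show ?thesis unfolding prod nonzero .
qed

text \<open>
  The rows and columns are indexed by arbitrary finite sets, since the application has critical
  points as rows and sets of indices as columns.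
\<close>

lemma right_inverse_imp_left_inverse:
  fixes P :: "'a \<Rightarrow> 'b \<Rightarrow> real" and Q :: "'b \<Rightarrow> 'a \<Rightarrow> real"
  assumes "finite X" "finite Y" "card X = card Y"
    and PQ: "\<And>x x'. x \<in> X \<Longrightarrow> x' \<in> X \<Longrightarrow> (\<Sum>y\<in>Y. P x y * Q y x') = (if x = x' then 1 else 0)"
    and "y \<in> Y" "y' \<in> Y"
  shows "(\<Sum>x\<in>X. Q y x * P x y') = (if y = y' then 1 else 0)"
proof -
  define N where "N = card X"
  obtain f where f: "bij_betw f {0..<N} X"
    using ex_bij_betw_nat_finite[OF \<open>finite X\<close>] N_def by blast
  obtain g where g: "bij_betw g {0..<N} Y"
    using ex_bij_betw_nat_finite[OF \<open>finite Y\<close>] N_def assms(3) by metis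
  have fX: "f i \<in> X" if "i < N" for i using f that by (auto simp: bij_betw_def)
  have f_eq: "f i = f j \<longleftrightarrow> i = j" if "i < N" "j < N" for i j
    using f that by (auto simp: bij_betw_def inj_on_def)
  have g_eq: "g i = g j \<longleftrightarrow> i = j" if "i < N" "j < N" for i j
    using g that by (auto simp: bij_betw_def inj_on_def)
  let ?P = "mat N N (\<lambda>(i, j). P (f i) (g j))" and ?Q = "mat N N (\<lambda>(i, j). Q (g i) (f j))"
  have "?P * ?Q = 1\<^sub>m N"
  proof (rule eq_matI)
    fix i j assume ij: "i < dim_row (1\<^sub>m N)" "j < dim_col (1\<^sub>m N)"
    then have "(?P * ?Q) $$ (i, j) = (\<Sum>k\<in>{0..<N}. P (f i) (g k) * Q (g k) (f j))"
      by (simp add: scalar_prod_def)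
    also have "\<dots> = (\<Sum>y\<in>Y. P (f i) y * Q y (f j))"
      by (rule sum.reindex_bij_betw[OF g])
    also have "\<dots> = 1\<^sub>m N $$ (i, j)"
      using ij by (simp add: PQ fX f_eq)
    finally show "(?P * ?Q) $$ (i, j) = 1\<^sub>m N $$ (i, j)" .
  qed auto
  then have QP: "?Q * ?P = 1\<^sub>m N"
    by (intro mat_mult_left_right_inverse[of ?P N ?Q]) auto
  obtain i j where ij: "i < N" "g i = y" "j < N" "g j = y'"
    using g assms(5,6) unfolding bij_betw_def by (metis (full_types) atLeastLessThan_iff imageE)
  have "(\<Sum>x\<in>X. Q y x * P x y') = (\<Sum>k\<in>{0..<N}. Q (g i) (f k) * P (f k) (g j))"
    using sum.reindex_bij_betw[OF f, of "\<lambda>x. Q y x * P x y'"] ij by simp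
  also have "\<dots> = (?Q * ?P) $$ (i, j)"
    using ij by (simp add: scalar_prod_def)
  also have "\<dots> = (if y = y' then 1 else 0)"
    unfolding QP using ij g_eq by auto
  finally show ?thesis .
qed

text \<open>
  In the Leibniz formula each factor contributes either its diagonal \<open>1\<close> or the product
  \<open>t i * A i (p i) * s (p i)\<close>.  If \<open>S\<close> collects the indices of the second kind, only permutations
  that fix the complement of \<open>S\<close> survive; such a permutation merely reorders the factors \<open>s\<close>.
\<close>

lemma principal_minor_add_diagonal:
  assumes "finite I"
  shows "principal_minor (\<lambda>i j. (if i = j then 1 else 0) + t i * A i j * s j) I =
    (\<Sum>S\<in>Pow I. principal_minor A S * (\<Prod>i\<in>S. t i) * (\<Prod>i\<in>S. s i))"
proof -
  let ?d = "\<lambda>i j. if i = j then 1 else 0 :: real"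
  have fin: "finite S" if "S \<in> Pow I" for S using that assms finite_subset by blast
  have "principal_minor (\<lambda>i j. ?d i j + t i * A i j * s j) I =
    (\<Sum>p | p permutes I. \<Sum>S\<in>Pow I. of_int (sign p) *
      ((\<Prod>i\<in>S. t i * A i (p i) * s (p i)) * (\<Prod>i\<in>I - S. ?d i (p i))))"
    unfolding principal_minor_def
    by (subst add.commute) (simp add: prod_add[OF assms] sum_distrib_left)
  also have "\<dots> = (\<Sum>S\<in>Pow I. \<Sum>p | p permutes I. of_int (sign p) *
      ((\<Prod>i\<in>S. t i * A i (p i) * s (p i)) * (\<Prod>i\<in>I - S. ?d i (p i))))"
    by (rule sum.swap)
  also have "\<dots> = (\<Sum>S\<in>Pow I. principal_minor A S * (\<Prod>i\<in>S. t i) * (\<Prod>i\<in>S. s i))"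
  proof (rule sum.cong[OF refl])
    fix S assume S: "S \<in> Pow I"
    let ?g = "\<lambda>p. of_int (sign p) *
      ((\<Prod>i\<in>S. t i * A i (p i) * s (p i)) * (\<Prod>i\<in>I - S. ?d i (p i)))"
    have "(\<Sum>p | p permutes I. ?g p) = (\<Sum>p | p permutes S. ?g p)"
    proof (rule sum.mono_neutral_right)
      show "finite {p. p permutes I}" using assms by (rule finite_permutations)
      show "{p. p permutes S} \<subseteq> {p. p permutes I}" using S permutes_subset by blast
      show "\<forall>p\<in>{p. p permutes I} - {p. p permutes S}. ?g p = 0"
      proof
        fix p assume p: "p \<in> {p. p permutes I} - {p. p permutes S}"
        have "\<exists>i\<in>I - S. i \<noteq> p i"
        proof (rule ccontr)
          assume "\<not> ?thesis"
          then have "p permutes S"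
            using p by (intro permutes_superset[of p I S]) auto
          then show False using p by simp
        qed
        then have "(\<Prod>i\<in>I - S. ?d i (p i)) = 0"
          using assms by (auto intro!: prod_zero)
        then show "?g p = 0" by simp
      qed
    qed
    also have "\<dots> = (\<Sum>p | p permutes S. of_int (sign p) * (\<Prod>i\<in>S. A i (p i)) *
        ((\<Prod>i\<in>S. t i) * (\<Prod>i\<in>S. s i)))"
    proof (rule sum.cong[OF refl])
      fix p assume p: "p \<in> {p. p permutes S}"
      have "(\<Prod>i\<in>I - S. ?d i (p i)) = 1"
        using p by (intro prod.neutral) (auto simp: permutes_def)
      moreover have "(\<Prod>i\<in>S. s (p i)) = (\<Prod>i\<in>S. s i)"
        using p by (intro prod.reindex_bij_betw permutes_imp_bij) simp
      ultimately show "?g p = of_int (sign p) * (\<Prod>i\<in>S. A i (p i)) *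
        ((\<Prod>i\<in>S. t i) * (\<Prod>i\<in>S. s i))"
        by (simp add: prod.distrib mult_ac)
    qed
    also have "\<dots> = principal_minor A S * (\<Prod>i\<in>S. t i) * (\<Prod>i\<in>S. s i)"
      unfolding principal_minor_def by (simp add: sum_distrib_right mult.assoc)
    finally show "sum ?g {p. p permutes I} = principal_minor A S * (\<Prod>i\<in>S. t i) * (\<Prod>i\<in>S. s i)" .
  qed
  finally show ?thesis .
qed

section \<open>Critical points in every orthant\<close>

definition qform :: "nat \<Rightarrow> (nat \<Rightarrow> nat \<Rightarrow> real) \<Rightarrow> (nat \<Rightarrow> real) \<Rightarrow> real" where
  "qform n A x = (\<Sum>i<n. \<Sum>j<n. A i j * x i * x j)"

text \<open>
  These are the critical points of \<open>qform n A t / 2 - (\<Sum>i<n. ln \<bar>t i\<bar>)\<close>, equivalently the vectors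
  whose image under \<open>A\<close> is their entrywise inverse.
\<close>

definition reciprocal :: "nat \<Rightarrow> (nat \<Rightarrow> nat \<Rightarrow> real) \<Rightarrow> (nat \<Rightarrow> real) \<Rightarrow> bool" where
  "reciprocal n A t \<longleftrightarrow> (\<forall>i<n. t i * (\<Sum>j<n. A i j * t j) = 1)"

text \<open>
  Positive definiteness is put as a bound with a constant \<open>\<mu>\<close> because this is what makes the
  function with critical points \<open>reciprocal n A\<close> proper.
\<close>

definition pd_correlation :: "nat \<Rightarrow> (nat \<Rightarrow> nat \<Rightarrow> real) \<Rightarrow> bool" where
  "pd_correlation n A \<longleftrightarrow> (\<forall>i<n. A i i = 1) \<and> (\<forall>i<n. \<forall>j<n. A i j = A j i) \<and>
     (\<exists>\<mu>>0. \<forall>x. \<mu> * (\<Sum>i<n. (x i)\<^sup>2) \<le> qform n A x)"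

lemma qform_row: "qform n A x = (\<Sum>i<n. x i * (\<Sum>j<n. A i j * x j))"
  unfolding qform_def by (simp add: sum_distrib_left mult_ac)

lemma qform_shift_coordinate:
  assumes A: "pd_correlation n A" and i: "i < n"
  shows "qform n A (x(i := x i + y)) = qform n A x + 2 * y * (\<Sum>j<n. A i j * x j) + y\<^sup>2"
proof -
  let ?e = "\<lambda>k. if k = i then y else 0"
  have upd: "x(i := x i + y) = (\<lambda>k. x k + ?e k)" by auto
  have sym: "(\<Sum>k<n. A k i * x k) = (\<Sum>k<n. A i k * x k)"
    using A i by (intro sum.cong) (auto simp: pd_correlation_def)
  have "qform n A (x(i := x i + y)) =
     (\<Sum>k<n. \<Sum>j<n. A k j * x k * x j) + (\<Sum>k<n. \<Sum>j<n. A k j * x k * ?e j)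
     + (\<Sum>k<n. \<Sum>j<n. A k j * ?e k * x j) + (\<Sum>k<n. \<Sum>j<n. A k j * ?e k * ?e j)"
    unfolding upd qform_def by (simp add: sum.distrib[symmetric] algebra_simps)
  also have "(\<Sum>k<n. \<Sum>j<n. A k j * x k * ?e j) = y * (\<Sum>k<n. A k i * x k)"
    using i by (simp add: if_distrib[of "\<lambda>z. _ * z"] sum.delta sum_distrib_left mult_ac cong: if_cong)
  also have "(\<Sum>k<n. \<Sum>j<n. A k j * ?e k * x j) = (\<Sum>k<n. if k = i then y * (\<Sum>j<n. A i j * x j) else 0)"
    by (intro sum.cong) (auto simp: sum_distrib_left mult_ac)
  also have "\<dots> = y * (\<Sum>j<n. A i j * x j)" using i by simp
  also have "(\<Sum>k<n. \<Sum>j<n. A k j * ?e k * ?e j) = (\<Sum>k<n. if k = i then A i i * y * y else 0)"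
    using i by (intro sum.cong) (auto simp: if_distrib[of "\<lambda>z. _ * z"] cong: if_cong)
  also have "\<dots> = y\<^sup>2" using i A by (simp add: pd_correlation_def power2_eq_square)
  finally show ?thesis unfolding sym by (simp add: qform_def)
qed

lemma reciprocal_neq_0:
  assumes "reciprocal n A t" "i < n"
  shows "t i \<noteq> 0"
  using assms by (auto simp: reciprocal_def)

lemma reciprocal_row:
  assumes "reciprocal n A t" "i < n"
  shows "(\<Sum>j<n. A i j * t j) = 1 / t i"
  using assms reciprocal_neq_0[OF assms] by (simp add: reciprocal_def field_simps)

text \<open>
  The bound is the Cauchy-Schwarz inequality for the form \<open>A\<close>, applied to \<open>t\<close> and the \<open>i\<close>-th unit
  vector, whose squared lengths are \<open>n\<close> and \<open>1\<close>.
\<close>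

lemma reciprocal_coordinate_le:
  assumes A: "pd_correlation n A" and t: "reciprocal n A t" and i: "i < n"
  shows "(1 / t i)\<^sup>2 \<le> real n"
proof -
  have "qform n A t = (\<Sum>i<n. 1)"
    unfolding qform_row using t by (intro sum.cong) (auto simp: reciprocal_def)
  then have q: "qform n A t = real n" by simp
  obtain \<mu> where mu: "\<mu> > 0" "\<mu> * (\<Sum>j<n. (x j)\<^sup>2) \<le> qform n A x" for x
    using A by (auto simp: pd_correlation_def)
  let ?y = "- (1 / t i)"
  have "0 \<le> \<mu> * (\<Sum>j<n. ((t(i := t i + ?y)) j)\<^sup>2)"
    using mu(1) by (intro mult_nonneg_nonneg sum_nonneg) auto
  also have "\<dots> \<le> qform n A (t(i := t i + ?y))" by (rule mu(2))
  also have "\<dots> = real n - (1 / t i)\<^sup>2"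
    unfolding qform_shift_coordinate[OF A i] q reciprocal_row[OF t i]
    by (simp add: power2_eq_square)
  finally show ?thesis by simp
qed

lemma compact_box:
  fixes B :: "'i \<Rightarrow> 'a :: topological_space set"
  assumes "\<And>i. compact (B i)"
  shows "compact (PiE UNIV B)"
proof -
  have "compactin (product_topology (\<lambda>i. euclidean) UNIV) (PiE UNIV B)"
    using assms by (simp add: compactin_PiE)
  then show ?thesis by (simp add: euclidean_product_topology)
qed

lemma barrier_lower_bound:
  fixes \<mu> x :: real
  assumes "\<mu> > 0" "x > 0"
  shows "\<mu> * x\<^sup>2 / 2 - ln x \<ge> 1 - 1 / (2 * \<mu>)"
proof -
  have "\<mu> * x\<^sup>2 / 2 - x + 1 / (2 * \<mu>) = (\<mu> * x - 1)\<^sup>2 / (2 * \<mu>)"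
    using assms by (simp add: field_simps power2_eq_square)
  also have "\<dots> \<ge> 0" using assms by simp
  finally show ?thesis using ln_le_minus_one[of x] assms by simp
qed

lemma barrier_proper:
  fixes \<mu> C :: real
  assumes "\<mu> > 0"
  obtains r R where "0 < r" "r < 1" "1 < R"
    "\<mu> * r\<^sup>2 / 2 - ln r > C" "\<mu> * R\<^sup>2 / 2 - ln R > C"
proof
  define K where "K = \<bar>C\<bar> + 1"
  define R where "R = max (4 / \<mu>) K + 1"
  have K: "K > 0" "K > C" by (auto simp: K_def)
  show "0 < exp (- K)" "exp (- K) < 1" using K by auto
  show "1 < R" using K by (auto simp: R_def)
  have "0 \<le> \<mu> * (exp (- K))\<^sup>2 / 2" using assms by simp
  then show "\<mu> * (exp (- K))\<^sup>2 / 2 - ln (exp (- K)) > C" using K by simp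
  have R: "R > 4 / \<mu>" "R > C" "R > 0" using K \<open>1 < R\<close> by (auto simp: R_def)
  then have "\<mu> * R > 4" using assms by (simp add: field_simps)
  then have "R * 1 \<le> R * (\<mu> * R / 2 - 1)" using R by (intro mult_left_mono) auto
  then have "R \<le> \<mu> * R\<^sup>2 / 2 - R" by (simp add: field_simps power2_eq_square)
  moreover have "ln R \<le> R" using ln_le_minus_one[of R] R by simp
  ultimately show "\<mu> * R\<^sup>2 / 2 - ln R > C" using R by simp
qed

text \<open>
  By \<open>barrier_lower_bound\<close> and \<open>barrier_proper\<close> the function tends to infinity at the boundary of
  the positive orthant and at infinity, so that its minimum over a large enough box is attained
  in the interior, where all partial derivatives vanish.
\<close>

lemma positive_reciprocal_exists:
  assumes A: "pd_correlation n A"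
  shows "\<exists>t. reciprocal n A t \<and> (\<forall>i<n. t i > 0)"
proof -
  obtain \<mu> where mu: "\<mu> > 0" "\<mu> * (\<Sum>j<n. (x j)\<^sup>2) \<le> qform n A x" for x
    using A by (auto simp: pd_correlation_def)
  define f where "f x = qform n A x / 2 - (\<Sum>i<n. ln (x i))" for x
  define g where "g x = \<mu> * x\<^sup>2 / 2 - ln x" for x
  define m where "m = 1 - 1 / (2 * \<mu>)"
  have g_ge: "g x \<ge> m" if "x > 0" for x
    unfolding g_def m_def using barrier_lower_bound[OF mu(1) that] .
  have f_ge: "f x \<ge> (\<Sum>i<n. g (x i))" for x
  proof -
    have "(\<Sum>i<n. g (x i)) = \<mu> * (\<Sum>i<n. (x i)\<^sup>2) / 2 - (\<Sum>i<n. ln (x i))"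
      by (simp add: g_def sum_subtractf sum_distrib_left sum_divide_distrib)
    then show ?thesis using mu(2)[of x] by (simp add: f_def)
  qed
  define one where "one i = (if i < n then 1 else 0 :: real)" for i
  obtain r R where rR: "0 < r" "r < 1" "1 < R"
    "g r > f one - (real n - 1) * m" "g R > f one - (real n - 1) * m"
    using barrier_proper[OF mu(1), of "f one - (real n - 1) * m"] unfolding g_def by blast
  \<comment> \<open>Coordinates from \<open>n\<close> on are pinned to \<open>0\<close>, which makes the box compact in the product topology.\<close>
  define B where "B = PiE UNIV (\<lambda>i. if i < n then {r..R} else {0 :: real})"
  have B_iff: "x \<in> B \<longleftrightarrow> (\<forall>i. if i < n then r \<le> x i \<and> x i \<le> R else x i = 0)" for x
    unfolding B_def by (auto simp: PiE_iff split: if_splits)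
  have "compact B" unfolding B_def by (rule compact_box) auto
  moreover have one: "one \<in> B" using rR by (auto simp: B_iff one_def)
  moreover have "continuous_on B f"
  proof -
    have "x i \<noteq> 0" if "x \<in> B" "i < n" for x i
      using that rR(1) unfolding B_iff by (metis less_le_not_le)
    then show ?thesis
      unfolding f_def qform_def
      by (intro continuous_intros continuous_on_subset[OF continuous_on_product_coordinates]) auto
  qed
  ultimately obtain x where x: "x \<in> B" and x_min: "\<And>z. z \<in> B \<Longrightarrow> f x \<le> f z"
    using continuous_attains_inf[of B f] by blast
  have x_box: "r \<le> x i" "x i \<le> R" if "i < n" for i
    using x that by (metis B_iff)+
  have x_pos: "x i > 0" if "i < n" for i using x_box[OF that] rR by simp
  \<comment> \<open>A coordinate at \<open>r\<close> or \<open>R\<close> would alone push the value above \<open>f one\<close>.\<close>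
  have interior: "r < x i \<and> x i < R" if i: "i < n" for i
  proof -
    have "(real n - 1) * m + g (x i) \<le> (\<Sum>j\<in>{..<n} - {i}. g (x j)) + g (x i)"
    proof -
      have "(real n - 1) * m = (\<Sum>j\<in>{..<n} - {i}. m)" using i by (simp add: of_nat_diff)
      also have "\<dots> \<le> (\<Sum>j\<in>{..<n} - {i}. g (x j))"
        by (intro sum_mono g_ge x_pos) auto
      finally show ?thesis by simp
    qed
    also have "\<dots> = (\<Sum>j<n. g (x j))" using i by (simp add: sum.remove[of _ i])
    also have "\<dots> \<le> f one" using f_ge[of x] x_min[OF one] by linarith
    finally have "g (x i) \<noteq> g r" "g (x i) \<noteq> g R" using rR by auto
    then have "x i \<noteq> r" "x i \<noteq> R" by auto
    then show ?thesis using x_box[OF i] by auto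
  qed
  have "x i * (\<Sum>j<n. A i j * x j) = 1" if i: "i < n" for i
  proof -
    let ?a = "\<Sum>j<n. A i j * x j"
    define h where "h y = qform n A x / 2 + y * ?a + y\<^sup>2 / 2
      - ((\<Sum>j\<in>{..<n} - {i}. ln (x j)) + ln (x i + y))" for y
    have h: "h y = f (x(i := x i + y))" for y
      unfolding h_def f_def qform_shift_coordinate[OF A i]
      using i by (simp add: sum.remove[of _ i])
    have der: "(h has_real_derivative (?a - 1 / x i)) (at 0)"
      unfolding h_def by (auto intro!: derivative_eq_intros simp: x_pos i)
    define d where "d = min (x i - r) (R - x i)"
    have "d > 0" using interior[OF i] by (simp add: d_def)
    moreover have "h 0 \<le> h y" if "\<bar>0 - y\<bar> < d" for y
    proof -
      have "x(i := x i + y) \<in> B" using x that i by (auto simp: B_iff d_def)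
      then show ?thesis using x_min[of "x(i := x i + y)"] unfolding h by simp
    qed
    ultimately have "?a - 1 / x i = 0"
      using DERIV_local_min[OF der, of d] by blast
    then show ?thesis using x_pos[OF i] by (simp add: field_simps)
  qed
  then show ?thesis using x_pos by (auto simp: reciprocal_def)
qed

text \<open>
  Conjugating \<open>A\<close> by a diagonal sign matrix reduces any orthant to the positive one.
\<close>

lemma reciprocal_exists_with_signs:
  assumes A: "pd_correlation n A"
  shows "\<exists>t. reciprocal n A t \<and> (\<forall>i<n. t i < 0 \<longleftrightarrow> i \<in> S)"
proof -
  define \<sigma> where "\<sigma> i = (if i \<in> S then -1 else 1 :: real)" for i
  have [simp]: "\<sigma> i * \<sigma> i = 1" "(\<sigma> i)\<^sup>2 = 1" for i by (auto simp: \<sigma>_def)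
  let ?B = "\<lambda>i j. \<sigma> i * A i j * \<sigma> j"
  have q: "qform n ?B x = qform n A (\<lambda>i. \<sigma> i * x i)" for x
    unfolding qform_def by (simp add: mult_ac)
  obtain \<mu> where mu: "\<mu> > 0" "\<mu> * (\<Sum>j<n. (x j)\<^sup>2) \<le> qform n A x" for x
    using A by (auto simp: pd_correlation_def)
  have "\<mu> * (\<Sum>j<n. (x j)\<^sup>2) \<le> qform n ?B x" for x
    unfolding q using mu(2)[of "\<lambda>i. \<sigma> i * x i"] by (simp add: power_mult_distrib)
  then have "pd_correlation n ?B"
    using A mu(1) by (auto simp: pd_correlation_def)
  then obtain t where t: "reciprocal n ?B t" "\<And>i. i < n \<Longrightarrow> t i > 0"
    using positive_reciprocal_exists by blast
  have "reciprocal n A (\<lambda>i. \<sigma> i * t i)"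
    unfolding reciprocal_def
  proof (intro allI impI)
    fix i assume "i < n"
    then have "t i * (\<Sum>j<n. ?B i j * t j) = 1" using t(1) by (simp add: reciprocal_def)
    then show "\<sigma> i * t i * (\<Sum>j<n. A i j * (\<sigma> j * t j)) = 1"
      by (simp add: sum_distrib_left mult_ac)
  qed
  moreover have "\<sigma> i * t i < 0 \<longleftrightarrow> i \<in> S" if "i < n" for i
    using t(2)[OF that] by (auto simp: \<sigma>_def)
  ultimately show ?thesis by blast
qed

section \<open>Orthogonality of monomials on the critical points\<close>

definition det_kernel :: "nat \<Rightarrow> (nat \<Rightarrow> nat \<Rightarrow> real) \<Rightarrow> (nat \<Rightarrow> real) \<Rightarrow> (nat \<Rightarrow> real) \<Rightarrow> real" where
  "det_kernel n A t s = principal_minor (\<lambda>i j. (if i = j then 1 else 0) + t i * A i j * s j) {..<n}"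

lemma det_kernel_expansion:
  "det_kernel n A t s = (\<Sum>S\<in>Pow {..<n}. principal_minor A S * (\<Prod>i\<in>S. t i) * (\<Prod>i\<in>S. s i))"
  unfolding det_kernel_def by (rule principal_minor_add_diagonal) simp

lemma principal_minor_empty: "principal_minor A {} = 1"
  by (simp add: principal_minor_def)

lemma principal_minor_singleton: "principal_minor A {i} = A i i"
  by (simp add: principal_minor_def)

lemma det_kernel_eq_0_iff:
  "det_kernel n A t s = 0 \<longleftrightarrow>
     (\<exists>y. (\<exists>i<n. y i \<noteq> 0) \<and> (\<forall>i<n. y i + t i * (\<Sum>j<n. A i j * (s j * y j)) = 0))"
proof -
  have row: "(\<Sum>j<n. ((if i = j then 1 else 0) + t i * A i j * s j) * y j) =
     y i + t i * (\<Sum>j<n. A i j * (s j * y j))" if "i < n" for i y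
  proof -
    have "(\<Sum>j<n. ((if i = j then 1 else 0) + t i * A i j * s j) * y j) =
      (\<Sum>j<n. (if i = j then y j else 0) + t i * (A i j * (s j * y j)))"
      by (intro sum.cong) (auto simp: algebra_simps)
    then show ?thesis using that by (simp add: sum.distrib sum_distrib_left)
  qed
  then show ?thesis
    unfolding det_kernel_def principal_minor_eq_0_iff by (simp add: row)
qed

text \<open>
  The vector \<open>y = (t - s) / s\<close> is in the null space: multiplying by \<open>s\<close> and then by \<open>A\<close> turns it
  into \<open>A t - A s\<close>, which is \<open>1 / t - 1 / s\<close> by criticality, and \<open>t * (1 / t - 1 / s) = - y\<close>.
\<close>

lemma det_kernel_distinct_eq_0:
  assumes t: "reciprocal n A t" and s: "reciprocal n A s" and "i < n" "t i \<noteq> s i"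
  shows "det_kernel n A t s = 0"
  unfolding det_kernel_eq_0_iff
proof (intro exI[of _ "\<lambda>i. (t i - s i) / s i"] conjI allI impI)
  show "\<exists>i<n. (t i - s i) / s i \<noteq> 0"
    using assms reciprocal_neq_0[OF s] by auto
  fix i assume i: "i < n"
  have "(\<Sum>j<n. A i j * (s j * ((t j - s j) / s j))) = (\<Sum>j<n. A i j * t j) - (\<Sum>j<n. A i j * s j)"
    unfolding sum_subtractf[symmetric]
  proof (rule sum.cong[OF refl])
    fix j assume "j \<in> {..<n}"
    then have "s j \<noteq> 0" using reciprocal_neq_0[OF s] by simp
    then have "s j * ((t j - s j) / s j) = t j - s j" by simp
    then show "A i j * (s j * ((t j - s j) / s j)) = A i j * t j - A i j * s j"
      by (simp only: right_diff_distrib)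
  qed
  also have "\<dots> = 1 / t i - 1 / s i"
    using reciprocal_row[OF t i] reciprocal_row[OF s i] by simp
  finally show "(t i - s i) / s i + t i * (\<Sum>j<n. A i j * (s j * ((t j - s j) / s j))) = 0"
    using reciprocal_neq_0[OF t i] reciprocal_neq_0[OF s i] by (simp add: field_simps)
qed

lemma det_kernel_diagonal_neq_0:
  assumes A: "\<And>x. qform n A x \<ge> 0"
  shows "det_kernel n A t t \<noteq> 0"
proof
  assume "det_kernel n A t t = 0"
  then obtain y k where k: "k < n" "y k \<noteq> 0"
    and y: "\<And>i. i < n \<Longrightarrow> y i + t i * (\<Sum>j<n. A i j * (t j * y j)) = 0"
    unfolding det_kernel_eq_0_iff by blast
  have "(\<Sum>i<n. (y i)\<^sup>2) + qform n A (\<lambda>i. t i * y i) =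
    (\<Sum>i<n. y i * (y i + t i * (\<Sum>j<n. A i j * (t j * y j))))"
    unfolding qform_row by (simp add: distrib_left sum.distrib power2_eq_square mult_ac)
  also have "\<dots> = 0" using y by simp
  finally have "(\<Sum>i<n. (y i)\<^sup>2) \<le> 0" using A[of "\<lambda>i. t i * y i"] by linarith
  moreover have "(\<Sum>i<n. (y i)\<^sup>2) > 0"
    using k by (intro sum_pos2[of _ k]) auto
  ultimately show False by simp
qed

text \<open>
  The determinant does not vanish along the segment from \<open>0\<close> to \<open>t\<close> and is \<open>1\<close> at its start.
\<close>

lemma det_kernel_diagonal_pos:
  assumes A: "\<And>x. qform n A x \<ge> 0"
  shows "det_kernel n A t t > 0"
proof (rule ccontr)
  assume neg: "\<not> det_kernel n A t t > 0"
  define f where "f c = det_kernel n A (\<lambda>i. c * t i) (\<lambda>i. c * t i)" for c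
  have cont: "continuous_on {0..1} f"
    unfolding f_def det_kernel_expansion by (intro continuous_intros)
  have "f 0 = (\<Sum>S\<in>Pow {..<n}. if S = {} then 1 else 0)"
    unfolding f_def det_kernel_expansion
  proof (rule sum.cong[OF refl])
    fix S assume "S \<in> Pow {..<n}"
    then have "finite S" using finite_subset by blast
    then show "principal_minor A S * (\<Prod>i\<in>S. 0 * t i) * (\<Prod>i\<in>S. 0 * t i) = (if S = {} then 1 else 0)"
      by (auto simp: principal_minor_empty)
  qed
  then have "f 0 = 1" by simp
  moreover have "f 1 \<le> 0" using neg by (simp add: f_def)
  ultimately obtain c where "f c = 0"
    using IVT2'[of f 1 0 0] cont by auto
  then show False using det_kernel_diagonal_neq_0[OF A] by (simp add: f_def)
qed

text \<open>
  One critical point \<open>\<tau> E\<close> is chosen for each set \<open>E\<close> of negative coordinates.  There are as many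
  of these as there are monomials, so the orthogonality of the rows given by
  \<open>det_kernel_distinct_eq_0\<close> passes to the columns.
\<close>

lemma reciprocal_orthogonality:
  assumes A: "pd_correlation n A"
  obtains \<tau> :: "nat set \<Rightarrow> nat \<Rightarrow> real" and w :: "nat set \<Rightarrow> real"
  where "\<And>E. reciprocal n A (\<tau> E)" "\<And>E. w E > 0"
    "\<And>S T. S \<subseteq> {..<n} \<Longrightarrow> T \<subseteq> {..<n} \<Longrightarrow>
      principal_minor A S * (\<Sum>E\<in>Pow {..<n}. w E * (\<Prod>i\<in>S. \<tau> E i) * (\<Prod>i\<in>T. \<tau> E i)) = (if S = T then 1 else 0)"
proof -
  obtain \<mu> where mu: "\<mu> > 0" "\<mu> * (\<Sum>j<n. (x j)\<^sup>2) \<le> qform n A x" for x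
    using A by (auto simp: pd_correlation_def)
  have psd: "qform n A x \<ge> 0" for x
    by (rule order_trans[OF _ mu(2)]) (use mu(1) in \<open>auto intro!: mult_nonneg_nonneg sum_nonneg\<close>)
  obtain \<tau> where rec: "\<And>E. reciprocal n A (\<tau> E)"
    and sgn: "\<And>E i. i < n \<Longrightarrow> \<tau> E i < 0 \<longleftrightarrow> i \<in> E"
    using reciprocal_exists_with_signs[OF A] by metis
  define w where "w E = 1 / det_kernel n A (\<tau> E) (\<tau> E)" for E
  have w_pos: "w E > 0" for E
    using det_kernel_diagonal_pos[OF psd] by (simp add: w_def)
  let ?I = "Pow {..<n}"
  define P where "P E S = (\<Prod>i\<in>S. \<tau> E i)" for E and S :: "nat set"
  define Q where "Q S E = w E * principal_minor A S * P E S" for E S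
  have PQ: "(\<Sum>S\<in>?I. P E S * Q S F) = (if E = F then 1 else 0)" if EF: "E \<in> ?I" "F \<in> ?I" for E F
  proof -
    have "(\<Sum>S\<in>?I. P E S * Q S F) = w F * det_kernel n A (\<tau> E) (\<tau> F)"
      unfolding det_kernel_expansion P_def Q_def by (simp add: sum_distrib_left mult_ac)
    also have "\<dots> = (if E = F then 1 else 0)"
    proof (cases "E = F")
      case True
      then show ?thesis using w_pos[of F] by (auto simp: w_def)
    next
      case False
      then obtain i where "i < n" "(i \<in> E) \<noteq> (i \<in> F)"
        using EF by blast
      then have "\<tau> E i \<noteq> \<tau> F i" using sgn by metis
      then show ?thesis
        using det_kernel_distinct_eq_0[OF rec rec \<open>i < n\<close>] False by simp
    qed
    finally show ?thesis .
  qed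
  have "principal_minor A S * (\<Sum>E\<in>?I. w E * P E S * P E T) = (if S = T then 1 else 0)"
    if "S \<in> ?I" "T \<in> ?I" for S T
  proof -
    have "(\<Sum>E\<in>?I. Q S E * P E T) = (if S = T then 1 else 0)"
      by (rule right_inverse_imp_left_inverse[OF _ _ _ PQ that]) auto
    then show ?thesis by (simp add: Q_def sum_distrib_left mult_ac)
  qed
  then show thesis using that rec w_pos unfolding P_def by auto
qed

section \<open>A critical point with large product\<close>

text \<open>
  The monomials of the empty set and of the singletons have minors \<open>1\<close> and \<open>A i i = 1\<close>.
\<close>

lemma reciprocal_moments:
  assumes A: "pd_correlation n A"
  obtains \<tau> :: "nat set \<Rightarrow> nat \<Rightarrow> real" and w :: "nat set \<Rightarrow> real"
  where "\<And>E. reciprocal n A (\<tau> E)" "\<And>E. w E > 0" "(\<Sum>E\<in>Pow {..<n}. w E) = 1"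
    "\<And>i j. i < n \<Longrightarrow> j < n \<Longrightarrow> (\<Sum>E\<in>Pow {..<n}. w E * (\<tau> E i * \<tau> E j)) = (if i = j then 1 else 0)"
proof -
  obtain \<tau> w where rec: "\<And>E. reciprocal n A (\<tau> E)" and pos: "\<And>E. w E > 0"
    and orth: "\<And>S T. S \<subseteq> {..<n} \<Longrightarrow> T \<subseteq> {..<n} \<Longrightarrow>
      principal_minor A S * (\<Sum>E\<in>Pow {..<n}. w E * (\<Prod>i\<in>S. \<tau> E i) * (\<Prod>i\<in>T. \<tau> E i)) = (if S = T then 1 else 0)"
    by (rule reciprocal_orthogonality[OF A]) blast
  have "(\<Sum>E\<in>Pow {..<n}. w E) = 1"
    using orth[of "{}" "{}"] by (simp add: principal_minor_empty)
  moreover have "(\<Sum>E\<in>Pow {..<n}. w E * (\<tau> E i * \<tau> E j)) = (if i = j then 1 else 0)"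
    if "i < n" "j < n" for i j
    using orth[of "{i}" "{j}"] A that
    by (simp add: principal_minor_singleton pd_correlation_def mult.assoc)
  ultimately show thesis using that rec pos by blast
qed

text \<open>
  For \<open>y \<le> c\<close> this improves \<open>ln y \<ge> 1 - 1 / y\<close> by a multiple of \<open>(y - 1)\<^sup>2 / y\<close>.  The constant is
  the one for which the difference of the two sides has derivative
  \<open>(y - 1) (c - y) / ((c + 1) y\<^sup>2)\<close>, so that its minimum on \<open>(0, c]\<close> is at \<open>y = 1\<close>.
\<close>

lemma log_lower_bound:
  fixes y c :: real
  assumes "0 < y" "y \<le> c" "1 \<le> c"
  shows "ln y \<ge> 1 - 1 / y + (y - 2 + 1 / y) / (c + 1)"
proof -
  define k where "k = 1 / (c + 1)"
  have k: "k > 0" "k * (c + 1) = 1" using assms by (auto simp: k_def)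
  define h where "h y = ln y - 1 + 1 / y - k * (y - 2 + 1 / y)" for y
  define h' where "h' y = k * (c - y) * (y - 1) / y\<^sup>2" for y
  have der: "(h has_real_derivative h' y) (at y)" if "y > 0" for y
  proof -
    have "(h has_real_derivative 1 / y - 1 / y\<^sup>2 - k * (1 - 1 / y\<^sup>2)) (at y)"
      unfolding h_def using that
      by (auto intro!: derivative_eq_intros simp: power2_eq_square)
    also have "1 / y - 1 / y\<^sup>2 - k * (1 - 1 / y\<^sup>2) =
      (k * (c + 1)) * (1 / y - 1 / y\<^sup>2) - k * (1 - 1 / y\<^sup>2)"
      using k(2) by simp
    also have "\<dots> = h' y"
      unfolding h'_def using that by (simp add: field_simps power2_eq_square)
    finally show ?thesis .
  qed
  have "h y \<ge> h 1"
  proof (cases "y \<le> 1")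
    case True
    show ?thesis
    proof (rule DERIV_nonpos_imp_nonincreasing[OF True])
      fix x assume "y \<le> x" "x \<le> 1"
      then show "\<exists>y. (h has_real_derivative y) (at x) \<and> y \<le> 0"
        using assms k(1)
        by (intro exI[of _ "h' x"] conjI der, simp, unfold h'_def, intro divide_nonpos_nonneg mult_nonneg_nonpos mult_nonneg_nonneg) auto
    qed
  next
    case False
    then have "1 \<le> y" by simp
    then show ?thesis
    proof (rule DERIV_nonneg_imp_nondecreasing)
      fix x assume "1 \<le> x" "x \<le> y"
      then show "\<exists>y. (h has_real_derivative y) (at x) \<and> y \<ge> 0"
        using assms k(1)
        by (intro exI[of _ "h' x"] conjI der) (auto simp: h'_def)
    qed
  qed
  then show ?thesis by (simp add: h_def k_def)
qed

text \<open>
  The logarithm of the product is averaged over the critical points.  With \<open>y = 1 / (t i)\<^sup>2\<close> the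
  means of \<open>1 / y\<close> and \<open>y\<close> are \<open>1\<close> and \<open>\<Sum>j<n. (A i j)\<^sup>2\<close>, so \<open>log_lower_bound\<close>, with \<open>c = n\<close> by
  \<open>reciprocal_coordinate_le\<close>, bounds the average below by the exponent in the statement.
\<close>

lemma reciprocal_large_product:
  assumes A: "pd_correlation n A"
  obtains t where "reciprocal n A t"
    "(\<Prod>i<n. (1 / t i)\<^sup>2) \<ge> exp ((\<Sum>i<n. (\<Sum>j<n. (A i j)\<^sup>2) - 1) / (real n + 1))"
proof -
  obtain \<tau> w where rec: "\<And>E. reciprocal n A (\<tau> E)" and pos: "\<And>E. w E > 0"
    and total: "(\<Sum>E\<in>Pow {..<n}. w E) = 1"
    and orth: "\<And>i j. i < n \<Longrightarrow> j < n \<Longrightarrow>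
      (\<Sum>E\<in>Pow {..<n}. w E * (\<tau> E i * \<tau> E j)) = (if i = j then 1 else 0)"
    by (rule reciprocal_moments[OF A]) blast
  let ?I = "Pow {..<n}"
  define G where "G = (\<Sum>i<n. (\<Sum>j<n. (A i j)\<^sup>2) - 1) / (real n + 1)"
  define x where "x E i = (1 / \<tau> E i)\<^sup>2" for E i
  have second: "(\<Sum>E\<in>?I. w E * (\<tau> E i)\<^sup>2) = 1" if "i < n" for i
    using orth[OF that that] by (simp add: power2_eq_square)
  have row_second: "(\<Sum>E\<in>?I. w E * x E i) = (\<Sum>j<n. (A i j)\<^sup>2)" if i: "i < n" for i
  proof -
    have "(\<Sum>E\<in>?I. w E * x E i) = (\<Sum>E\<in>?I. \<Sum>j<n. \<Sum>k<n. A i j * A i k * (w E * (\<tau> E j * \<tau> E k)))"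
      unfolding x_def reciprocal_row[OF rec i, symmetric]
      by (simp add: power2_eq_square sum_product sum_distrib_left mult_ac)
    also have "\<dots> = (\<Sum>j<n. \<Sum>k<n. A i j * A i k * (\<Sum>E\<in>?I. w E * (\<tau> E j * \<tau> E k)))"
      unfolding sum_distrib_left
      by (subst sum.swap, intro sum.cong refl, rule sum.swap)
    also have "\<dots> = (\<Sum>j<n. (A i j)\<^sup>2)"
      by (intro sum.cong refl) (simp add: orth if_distrib[of "\<lambda>z. _ * z"] power2_eq_square cong: if_cong)
    finally show ?thesis .
  qed
  have "\<exists>E\<in>?I. G \<le> (\<Sum>i<n. ln (x E i))"
  proof (rule ccontr)
    assume neg: "\<not> ?thesis"
    have less: "(\<Sum>i<n. ln (x E i)) < G" if "E \<in> ?I" for E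
      using neg that by (meson not_le)
    have "(\<Sum>E\<in>?I. w E * (\<Sum>i<n. ln (x E i))) < (\<Sum>E\<in>?I. w E * G)"
      by (intro sum_strict_mono mult_strict_left_mono less pos) auto
    also have "\<dots> = G" by (simp add: total flip: sum_distrib_right)
    finally have "(\<Sum>E\<in>?I. w E * (\<Sum>i<n. ln (x E i))) < G" .
    moreover have "G \<le> (\<Sum>E\<in>?I. w E * (\<Sum>i<n. ln (x E i)))"
    proof -
      let ?low = "\<lambda>E i. 1 - (\<tau> E i)\<^sup>2 + (x E i - 2 + (\<tau> E i)\<^sup>2) / (real n + 1)"
      have "G = (\<Sum>i<n. 1 - 1 + ((\<Sum>j<n. (A i j)\<^sup>2) - 2 + 1) / (real n + 1))"
        by (simp add: G_def sum_divide_distrib)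
      also have "\<dots> = (\<Sum>i<n. \<Sum>E\<in>?I. w E * ?low E i)"
      proof (rule sum.cong[OF refl])
        fix i assume "i \<in> {..<n}"
        then have i: "i < n" by simp
        have "(\<Sum>E\<in>?I. w E * ?low E i) =
          (\<Sum>E\<in>?I. w E) - (\<Sum>E\<in>?I. w E * (\<tau> E i)\<^sup>2) +
          ((\<Sum>E\<in>?I. w E * x E i) - 2 * (\<Sum>E\<in>?I. w E) + (\<Sum>E\<in>?I. w E * (\<tau> E i)\<^sup>2)) / (real n + 1)"
          by (simp add: sum_distrib_left sum_divide_distrib flip: sum.distrib sum_subtractf)
            (simp add: algebra_simps)
        then show "1 - 1 + ((\<Sum>j<n. (A i j)\<^sup>2) - 2 + 1) / (real n + 1) = (\<Sum>E\<in>?I. w E * ?low E i)"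
          by (simp add: total second[OF i] row_second[OF i])
      qed
      also have "\<dots> \<le> (\<Sum>i<n. \<Sum>E\<in>?I. w E * ln (x E i))"
      proof (intro sum_mono mult_left_mono)
        fix i E assume "i \<in> {..<n}"
        then have i: "i < n" by simp
        have "x E i > 0" "1 / x E i = (\<tau> E i)\<^sup>2"
          using reciprocal_neq_0[OF rec i] by (auto simp: x_def power_divide)
        then show "?low E i \<le> ln (x E i)"
          using log_lower_bound[of "x E i" "real n"] reciprocal_coordinate_le[OF A rec i] i
          by (simp add: x_def)
      qed (use pos less_imp_le in blast)
      also have "\<dots> = (\<Sum>E\<in>?I. w E * (\<Sum>i<n. ln (x E i)))"
        by (subst sum.swap) (simp add: sum_distrib_left)
      finally show ?thesis .
    qed
    ultimately show False by simp
  qed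
  then obtain E where E: "G \<le> (\<Sum>i<n. ln (x E i))" by blast
  have "exp G \<le> exp (\<Sum>i<n. ln (x E i))" using E by simp
  also have "\<dots> = (\<Prod>i<n. x E i)"
    using reciprocal_neq_0[OF rec] by (simp add: exp_sum x_def)
  finally show thesis using that[OF rec] unfolding x_def G_def by blast
qed

text \<open>
  The excess over \<open>1\<close> measures the distance from orthonormality.  The Gram matrix may be singular,
  so the preceding lemma is applied to a perturbation by \<open>\<delta>\<close>; the critical points stay bounded as
  \<open>\<delta>\<close> tends to \<open>0\<close> because each \<open>(1 / t i)\<^sup>2\<close> is at most \<open>n\<close> while their product is at least \<open>1\<close>.
\<close>

lemma product_bound_stability:
  fixes v :: "nat \<Rightarrow> 'a :: real_inner" and M :: real
  assumes unit: "\<And>i. i < n \<Longrightarrow> norm (v i) = 1"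
    and M: "\<And>u. (\<Prod>i<n. \<bar>v i \<bullet> u\<bar>) \<le> M * norm u ^ n" and "n \<ge> 1"
  shows "M\<^sup>2 * real n ^ n \<ge> exp ((\<Sum>i<n. \<Sum>j\<in>{..<n} - {i}. (v i \<bullet> v j)\<^sup>2) / (real n + 1))"
proof -
  define D where "D = (\<Sum>i<n. \<Sum>j\<in>{..<n} - {i}. (v i \<bullet> v j)\<^sup>2)"
  define K where "K = real n ^ n"
  have D: "D \<ge> 0" unfolding D_def by (intro sum_nonneg) auto
  have K: "K \<ge> 1" using \<open>n \<ge> 1\<close> by (simp add: K_def)
  have vv: "v i \<bullet> v i = 1" if "i < n" for i
    using unit[OF that] by (simp add: norm_eq_1)
  have main: "exp (D / (1 + \<delta>)\<^sup>2 / (real n + 1)) * (1 - \<delta> * K) ^ (2 * n) \<le> M\<^sup>2 * ((1 + \<delta>) * real n) ^ n"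
    if d: "0 < \<delta>" "\<delta> * K < 1" for \<delta> :: real
  proof -
    define A where "A i j = (v i \<bullet> v j + (if i = j then \<delta> else 0)) / (1 + \<delta>)" for i j
    have q: "qform n A x = ((norm (\<Sum>i<n. x i *\<^sub>R v i))\<^sup>2 + \<delta> * (\<Sum>i<n. (x i)\<^sup>2)) / (1 + \<delta>)" for x
    proof -
      have "(norm (\<Sum>i<n. x i *\<^sub>R v i))\<^sup>2 = (\<Sum>i<n. \<Sum>j<n. x i * x j * (v i \<bullet> v j))"
        unfolding power2_norm_eq_inner
      by (simp add: inner_sum_left inner_sum_right sum_distrib_left mult_ac inner_commute)
      moreover have "\<delta> * (\<Sum>i<n. (x i)\<^sup>2) = (\<Sum>i<n. \<Sum>j<n. x i * x j * (if i = j then \<delta> else 0))"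
        by (simp add: if_distrib[of "\<lambda>z. _ * z"] sum_distrib_left power2_eq_square mult_ac cong: if_cong)
      ultimately have "(norm (\<Sum>i<n. x i *\<^sub>R v i))\<^sup>2 + \<delta> * (\<Sum>i<n. (x i)\<^sup>2) =
          (\<Sum>i<n. \<Sum>j<n. x i * x j * (v i \<bullet> v j + (if i = j then \<delta> else 0)))"
        by (simp add: sum.distrib distrib_left)
      then show ?thesis
        unfolding qform_def A_def by (simp add: sum_divide_distrib mult_ac)
    qed
    have A: "pd_correlation n A"
      unfolding pd_correlation_def
    proof (intro conjI allI impI exI[of _ "\<delta> / (1 + \<delta>)"])
      show "A i i = 1" if "i < n" for i using that d by (simp add: A_def vv)
      show "A i j = A j i" for i j by (simp add: A_def inner_commute)
      show "\<delta> / (1 + \<delta>) * (\<Sum>i<n. (x i)\<^sup>2) \<le> qform n A x" for x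
        unfolding q using d by (simp add: divide_right_mono)
    qed (use d in simp)
    obtain t where t: "reciprocal n A t"
      and prod: "(\<Prod>i<n. (1 / t i)\<^sup>2) \<ge> exp ((\<Sum>i<n. (\<Sum>j<n. (A i j)\<^sup>2) - 1) / (real n + 1))"
      by (rule reciprocal_large_product[OF A])
    have "(\<Sum>i<n. (\<Sum>j<n. (A i j)\<^sup>2) - 1) = (\<Sum>i<n. \<Sum>j\<in>{..<n} - {i}. (v i \<bullet> v j)\<^sup>2 / (1 + \<delta>)\<^sup>2)"
    proof (rule sum.cong[OF refl])
      fix i assume i: "i \<in> {..<n}"
      then have "(\<Sum>j<n. (A i j)\<^sup>2) = 1 + (\<Sum>j\<in>{..<n} - {i}. (A i j)\<^sup>2)"
        using A by (simp add: sum.remove[of "{..<n}" i] pd_correlation_def)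
      also have "(\<Sum>j\<in>{..<n} - {i}. (A i j)\<^sup>2) = (\<Sum>j\<in>{..<n} - {i}. (v i \<bullet> v j)\<^sup>2 / (1 + \<delta>)\<^sup>2)"
        by (intro sum.cong) (auto simp: A_def power_divide)
      finally show "(\<Sum>j<n. (A i j)\<^sup>2) - 1 = (\<Sum>j\<in>{..<n} - {i}. (v i \<bullet> v j)\<^sup>2 / (1 + \<delta>)\<^sup>2)" by simp
    qed
    also have "\<dots> = D / (1 + \<delta>)\<^sup>2" by (simp add: D_def sum_divide_distrib)
    finally have prod: "(\<Prod>i<n. (1 / t i)\<^sup>2) \<ge> exp (D / (1 + \<delta>)\<^sup>2 / (real n + 1))"
      using prod by simp
    also have "exp (D / (1 + \<delta>)\<^sup>2 / (real n + 1)) \<ge> 1" using D by simp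
    finally have prod1: "(\<Prod>i<n. (1 / t i)\<^sup>2) \<ge> 1" by simp
    have t_le: "(t i)\<^sup>2 \<le> K" if i: "i < n" for i
    proof -
      have "(\<Prod>j\<in>{..<n} - {i}. (1 / t j)\<^sup>2) \<le> (\<Prod>j\<in>{..<n} - {i}. real n)"
        by (intro prod_mono) (use reciprocal_coordinate_le[OF A t] in auto)
      also have "\<dots> \<le> K"
        using i \<open>n \<ge> 1\<close> unfolding K_def by (simp add: power_increasing)
      finally have "1 \<le> (1 / t i)\<^sup>2 * K"
        using prod1 i mult_left_mono[of _ K "(1 / t i)\<^sup>2"]
        by (fastforce simp: prod.remove[of "{..<n}" i])
      then show ?thesis
        using reciprocal_neq_0[OF t i] by (simp add: power_divide field_simps)
    qed
    define u where "u = (\<Sum>i<n. t i *\<^sub>R v i)"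
    have u_coord: "v i \<bullet> u = (1 / t i) * (1 + \<delta> - \<delta> * (t i)\<^sup>2)" if i: "i < n" for i
    proof -
      have "(\<Sum>j<n. A i j * t j) = (\<Sum>j<n. (v i \<bullet> v j) * t j + (if i = j then \<delta> * t j else 0)) / (1 + \<delta>)"
        unfolding A_def sum_divide_distrib by (intro sum.cong) (auto simp: algebra_simps)
      also have "\<dots> = (v i \<bullet> u + \<delta> * t i) / (1 + \<delta>)"
        using i by (simp add: sum.distrib u_def inner_sum_right mult_ac)
      finally have "v i \<bullet> u + \<delta> * t i = (1 + \<delta>) * (1 / t i)"
        using d unfolding reciprocal_row[OF t i] by (simp add: field_simps)
      then show ?thesis
        using reciprocal_neq_0[OF t i] by (simp add: field_simps power2_eq_square)
    qed
    have u_norm: "(norm u)\<^sup>2 \<le> (1 + \<delta>) * real n"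
    proof -
      have "qform n A t = (\<Sum>i<n. 1)"
        unfolding qform_row using t by (intro sum.cong) (auto simp: reciprocal_def)
      then have "(norm u)\<^sup>2 + \<delta> * (\<Sum>i<n. (t i)\<^sup>2) = (1 + \<delta>) * real n"
        using d unfolding q u_def by (simp add: field_simps)
      moreover have "\<delta> * (\<Sum>i<n. (t i)\<^sup>2) \<ge> 0" using d by (simp add: sum_nonneg)
      ultimately show ?thesis by linarith
    qed
    have "exp (D / (1 + \<delta>)\<^sup>2 / (real n + 1)) * (1 - \<delta> * K) ^ (2 * n)
      \<le> (\<Prod>i<n. (1 / t i)\<^sup>2) * (\<Prod>i<n. (1 - \<delta> * K)\<^sup>2)"
      using prod d by (simp add: power_mult mult_right_mono)
    also have "\<dots> = (\<Prod>i<n. (1 / t i)\<^sup>2 * (1 - \<delta> * K)\<^sup>2)" by (simp only: prod.distrib)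
    also have "\<dots> \<le> (\<Prod>i<n. (v i \<bullet> u)\<^sup>2)"
    proof (intro prod_mono conjI)
      fix i assume "i \<in> {..<n}"
      then have i: "i < n" by simp
      have "\<delta> * (t i)\<^sup>2 \<le> \<delta> * K" using d t_le[OF i] by simp
      then have "1 - \<delta> * K \<le> 1 + \<delta> - \<delta> * (t i)\<^sup>2" using d by linarith
      then have "(1 - \<delta> * K)\<^sup>2 \<le> (1 + \<delta> - \<delta> * (t i)\<^sup>2)\<^sup>2"
        using d by (intro power_mono) auto
      then show "(1 / t i)\<^sup>2 * (1 - \<delta> * K)\<^sup>2 \<le> (v i \<bullet> u)\<^sup>2"
        unfolding u_coord[OF i] power_mult_distrib by (intro mult_left_mono) auto
    qed auto
    also have "\<dots> = (\<Prod>i<n. \<bar>v i \<bullet> u\<bar>)\<^sup>2" by (simp add: prod_power_distrib)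
    also have "\<dots> \<le> (M * norm u ^ n)\<^sup>2" by (intro power_mono M prod_nonneg) auto
    also have "\<dots> = M\<^sup>2 * ((norm u)\<^sup>2) ^ n" by (simp add: power_mult_distrib mult.commute flip: power_mult)
    also have "\<dots> \<le> M\<^sup>2 * ((1 + \<delta>) * real n) ^ n"
      using u_norm by (intro mult_left_mono power_mono) auto
    finally show ?thesis .
  qed
  let ?f = "\<lambda>\<delta>. exp (D / (1 + \<delta>)\<^sup>2 / (real n + 1)) * (1 - \<delta> * K) ^ (2 * n)"
  have "(?f \<longlongrightarrow> exp (D / (1 + 0)\<^sup>2 / (real n + 1)) * (1 - 0 * K) ^ (2 * n)) (at_right 0)"
    by (intro tendsto_intros) auto
  moreover have "((\<lambda>\<delta>. M\<^sup>2 * ((1 + \<delta>) * real n) ^ n) \<longlongrightarrow> M\<^sup>2 * ((1 + 0) * real n) ^ n) (at_right 0)"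
    by (intro tendsto_intros)
  moreover have "eventually (\<lambda>\<delta>. ?f \<delta> \<le> M\<^sup>2 * ((1 + \<delta>) * real n) ^ n) (at_right 0)"
    unfolding eventually_at_right_field
    using K main by (intro exI[of _ "1 / K"]) (auto simp: field_simps)
  ultimately have "exp (D / (1 + 0)\<^sup>2 / (real n + 1)) * (1 - 0 * K) ^ (2 * n) \<le> M\<^sup>2 * ((1 + 0) * real n) ^ n"
    by (intro tendsto_le[of "at_right 0"]) auto
  then show ?thesis by (simp add: D_def)
qed

section \<open>Orthonormal families and the extremal case\<close>

lemma orthonormal_family_Bessel:
  fixes v :: "nat \<Rightarrow> 'a :: real_inner"
  assumes "orthonormal_family n v"
  shows "(\<Sum>j=1..n. (v j \<bullet> u)\<^sup>2) \<le> (norm u)\<^sup>2"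
proof -
  define p where "p = (\<Sum>j=1..n. (v j \<bullet> u) *\<^sub>R v j)"
  have pu: "p \<bullet> u = (\<Sum>j=1..n. (v j \<bullet> u)\<^sup>2)"
    by (simp add: p_def inner_sum_left power2_eq_square)
  have "v j \<bullet> p = v j \<bullet> u" if "j \<in> {1..n}" for j
  proof -
    have "v j \<bullet> p = (\<Sum>k=1..n. if k = j then v k \<bullet> u else 0)"
      unfolding p_def inner_sum_right using assms that
      by (intro sum.cong) (auto simp: orthonormal_family_def)
    then show ?thesis using that by simp
  qed
  then have "p \<bullet> p = (\<Sum>j=1..n. (v j \<bullet> u)\<^sup>2)"
    by (subst p_def) (simp add: inner_sum_left power2_eq_square)
  moreover have "0 \<le> (u - p) \<bullet> (u - p)" by simp
  ultimately show ?thesis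
    using pu by (simp add: inner_diff_left inner_diff_right inner_commute power2_norm_eq_inner)
qed

text \<open>
  The numbers \<open>n * (v j \<bullet> u)\<^sup>2\<close> have sum at most \<open>n\<close>, and \<open>y \<le> exp (y - 1)\<close> gives the inequality of
  arithmetic and geometric means for them.
\<close>

lemma orthonormal_family_product_le:
  fixes v :: "nat \<Rightarrow> 'a :: real_inner"
  assumes "orthonormal_family n v" "norm u = 1"
  shows "(\<Prod>j=1..n. \<bar>v j \<bullet> u\<bar>)\<^sup>2 * real n ^ n \<le> 1"
proof -
  have "(\<Prod>j=1..n. \<bar>v j \<bullet> u\<bar>)\<^sup>2 * real n ^ n = (\<Prod>j=1..n. real n * (v j \<bullet> u)\<^sup>2)"
    by (simp add: prod.distrib prod_power_distrib)
  also have "\<dots> \<le> (\<Prod>j=1..n. exp (real n * (v j \<bullet> u)\<^sup>2 - 1))"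
    by (intro prod_mono conjI order_trans[OF _ exp_ge_add_one_self]) auto
  also have "\<dots> = exp (real n * (\<Sum>j=1..n. (v j \<bullet> u)\<^sup>2) - real n)"
    by (simp add: sum_subtractf sum_distrib_left flip: exp_sum)
  also have "\<dots> \<le> 1"
    using orthonormal_family_Bessel[OF assms(1), of u] assms(2)
    by (simp add: mult_left_le)
  finally show ?thesis .
qed

lemma orthonormal_family_card_le:
  fixes v :: "nat \<Rightarrow> 'a :: euclidean_space"
  assumes "orthonormal_family n v"
  shows "n \<le> DIM('a)"
proof -
  have v: "v j \<bullet> v k = (if j = k then 1 else 0)" if "j \<in> {1..n}" "k \<in> {1..n}" for j k
    using assms that by (simp add: orthonormal_family_def)
  have inj: "inj_on v {1..n}"
    by (rule inj_onI) (metis v zero_neq_one)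
  have "independent (v ` {1..n})"
  proof (rule pairwise_orthogonal_independent)
    show "pairwise Linear_Algebra.orthogonal (v ` {1..n})"
      unfolding pairwise_def Linear_Algebra.orthogonal_def using v by auto
    show "0 \<notin> v ` {1..n}" using v by force
  qed
  then have "card (v ` {1..n}) \<le> DIM('a)" using independent_bound by blast
  then show ?thesis using card_image[OF inj] by simp
qed

theorem mainTheorem3:
  fixes n :: nat and v :: "nat \<Rightarrow> real ^ 'd"
  assumes "n \<ge> 1"
    and "\<forall>j\<in>{1..n}. v j \<in> sphere 0 1"
  shows "(\<exists>u\<in>sphere 0 1. (\<Prod>j=1..n. \<bar>v j \<bullet> u\<bar>) \<ge> real n powr (- (real n / 2)))
    \<and> ((SUP x\<in>sphere 0 1. \<bar>\<Prod>j=1..n. v j \<bullet> x\<bar>) = real n powr (- (real n / 2))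
        \<longleftrightarrow> CARD('d) \<ge> n \<and> orthonormal_family n v)"
proof -
  define F where "F x = (\<Prod>j=1..n. \<bar>v j \<bullet> x\<bar>)" for x
  define c where "c = real n powr (- (real n / 2))"
  have c: "c > 0" "c\<^sup>2 * real n ^ n = 1"
    using assms(1) by (auto simp: c_def power2_eq_square powr_realpow[symmetric] simp flip: powr_add)
  have unit: "norm (v j) = 1" if "j \<in> {1..n}" for j using assms(2) that by simp
  have "continuous_on (sphere 0 1) F"
    unfolding F_def by (intro continuous_intros)
  moreover have "sphere (0 :: real ^ 'd) 1 \<noteq> {}" by simp
  ultimately obtain u where u: "u \<in> sphere 0 1" and u_max: "\<And>x. x \<in> sphere 0 1 \<Longrightarrow> F x \<le> F u"
    using continuous_attains_sup[OF compact_sphere] by metis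
  have Fu: "F u \<ge> 0" unfolding F_def by (intro prod_nonneg) auto
  have sup: "(SUP x\<in>sphere 0 1. \<bar>\<Prod>j=1..n. v j \<bullet> x\<bar>) = F u"
    unfolding abs_prod F_def[symmetric] using u u_max by (intro cSup_eq_maximum) auto
  have F_le: "F x \<le> F u * norm x ^ n" for x
  proof (cases "x = 0")
    case True
    then show ?thesis using assms(1) by (simp add: F_def power_0_left)
  next
    case False
    define y where "y = x /\<^sub>R norm x"
    have y: "y \<in> sphere 0 1" using False by (simp add: y_def)
    have "x = norm x *\<^sub>R y" using False by (simp add: y_def)
    then have "\<bar>v j \<bullet> x\<bar> = norm x * \<bar>v j \<bullet> y\<bar>" for j
      by (metis abs_mult abs_norm_cancel inner_scaleR_right)
    then have "F x = norm x ^ n * F y" by (simp add: F_def prod.distrib)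
    then show ?thesis using u_max[OF y] by (simp add: mult.commute mult_right_mono)
  qed
  define D where "D = (\<Sum>i<n. \<Sum>j\<in>{..<n} - {i}. (v (Suc i) \<bullet> v (Suc j))\<^sup>2)"
  have shift: "F x = (\<Prod>j<n. \<bar>v (Suc j) \<bullet> x\<bar>)" for x
    unfolding F_def by (simp add: prod.atLeast1_atMost_eq)
  have stability: "(F u)\<^sup>2 * real n ^ n \<ge> exp (D / (real n + 1))"
    unfolding D_def
    by (rule product_bound_stability) (use F_le unit assms(1) in \<open>simp_all add: shift[symmetric]\<close>)
  have D: "D \<ge> 0" unfolding D_def by (intro sum_nonneg) auto
  then have "(F u)\<^sup>2 * real n ^ n \<ge> c\<^sup>2 * real n ^ n"
    using stability c(2) by (smt (verit) divide_nonneg_nonneg of_nat_0_le_iff one_le_exp_iff)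
  then have F_ge: "F u \<ge> c"
    using Fu assms(1) power2_le_imp_le[of c "F u"] by simp
  have "F u = c \<longleftrightarrow> CARD('d) \<ge> n \<and> orthonormal_family n v"
  proof
    assume "F u = c"
    then have "exp (D / (real n + 1)) \<le> 1" using stability c(2) by simp
    then have "D = 0" using D by (simp add: divide_le_0_iff)
    then have zero: "v (Suc i) \<bullet> v (Suc j) = 0" if "i < n" "j < n" "i \<noteq> j" for i j
      using that unfolding D_def by (auto simp: sum_nonneg_eq_0_iff sum_nonneg)
    have "orthonormal_family n v"
      unfolding orthonormal_family_def
    proof (intro ballI)
      fix j k assume jk: "j \<in> {1..n}" "k \<in> {1..n}"
      then show "v j \<bullet> v k = (if j = k then 1 else 0)"
        using zero[of "j - 1" "k - 1"] unit[of j] by (auto simp: norm_eq_1)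
    qed
    then show "CARD('d) \<ge> n \<and> orthonormal_family n v"
      using orthonormal_family_card_le[of n v] by simp
  next
    assume "CARD('d) \<ge> n \<and> orthonormal_family n v"
    then have "(F u)\<^sup>2 * real n ^ n \<le> c\<^sup>2 * real n ^ n"
      using orthonormal_family_product_le[of n v u] u c(2) by (simp add: F_def)
    then have "F u \<le> c"
      using c(1) assms(1) power2_le_imp_le[of "F u" c] by simp
    then show "F u = c" using F_ge by simp
  qed
  then show ?thesis
    unfolding sup c_def[symmetric] F_def[symmetric] using F_ge u by blast
qed

end
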